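(* Let $L$ be a $d$-dimensional tropical linear space in $n$-space with $n=2d$ or $n=2d+1$. Then $L$ has at most $1$ bounded $d$-dimensional face if $n=2d$, and at most $d$ bounded $d$-dimensional faces if $n=2d+1$.
   Context: A function $p:\binom{[n]}{d}\to\mathbb{R}$ is a tropical Plücker vector if for every $S\in\binom{[n]}{d-2}$ and distinct $i,j,k,l\notin S$, the minimum of $p_{S\cup\{i,j\}}+p_{S\cup\{k,l\}}$, $p_{S\cup\{i,k\}}+p_{S\cup\{j,l\}}$, $p_{S\cup\{i,l\}}+p_{S\cup\{j,k\}}$ is attained at least twice. A $d$-dimensional tropical linear space in $n$-space is $L(p)=\{x\in\mathbb{R}^n:$ for every $J\in\binom{[n]}{d+1}$ the minimum over $j\in J$ of $p_{J\setminus\{j\}}+x_j$ is attained at least twice$\}$ for such $p$. For $w\in\mathbb{R}^n$ let $M_w$ be the set of $I$ minimizing $p_I-\sum_{i\in I}w_i$; faces of $L(p)$ are closures of the sets $\{w:M_w=\mathcal{M}\}$ contained in $L(p)$, their dimension is that of their affine hull in $\mathbb{R}^n$, and a face is bounded if its image in $\mathbb{R}^n/\mathbb{R}(1,\dots,1)$ is bounded. *)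

theory Defs
  imports "HOL-Analysis.Analysis"
begin

text \<open>
  The ground set \<open>[n]\<close> is a finite type \<open>'n\<close> with \<open>CARD('n) = n\<close>. A function on the
  \<open>d\<close>-subsets of \<open>[n]\<close> is given as a function on all subsets; its values on sets of
  cardinality other than \<open>d\<close> are never used below.
\<close>

text \<open>For finite \<open>A\<close>: the minimum of \<open>f\<close> over \<open>A\<close> is attained at two or more indices.\<close>

definition min_attained_twice :: "'i set \<Rightarrow> ('i \<Rightarrow> real) \<Rightarrow> bool" where
  "min_attained_twice A f \<longleftrightarrow> 2 \<le> card {a \<in> A. \<forall>b \<in> A. f a \<le> f b}"

text \<open>
  The condition \<open>card S + 2 = d\<close> is used instead of \<open>card S = d - 2\<close> because of truncated
  subtraction: for \<open>d < 2\<close> there are no relations. The three sums are indexed by their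
  position in a list, so that equal values count as distinct attainments.
\<close>

definition tropical_pluecker_vector :: "nat \<Rightarrow> ('n::finite set \<Rightarrow> real) \<Rightarrow> bool" where
  "tropical_pluecker_vector d p \<longleftrightarrow>
    (\<forall>S i j k l. card S + 2 = d \<longrightarrow> distinct [i, j, k, l] \<longrightarrow> {i, j, k, l} \<inter> S = {} \<longrightarrow>
      min_attained_twice {..<3}
        (\<lambda>t. [p (S \<union> {i, j}) + p (S \<union> {k, l}),
              p (S \<union> {i, k}) + p (S \<union> {j, l}),
              p (S \<union> {i, l}) + p (S \<union> {j, k})] ! t))"

definition tropical_linear_space :: "nat \<Rightarrow> ('n::finite set \<Rightarrow> real) \<Rightarrow> (real ^ 'n) set" where
  "tropical_linear_space d p =
    {x. \<forall>J. card J = d + 1 \<longrightarrow> min_attained_twice J (\<lambda>j. p (J - {j}) + x $ j)}"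

definition min_sets :: "nat \<Rightarrow> ('n::finite set \<Rightarrow> real) \<Rightarrow> real ^ 'n \<Rightarrow> 'n set set" where
  "min_sets d p w =
    {I. card I = d \<and>
        (\<forall>I'. card I' = d \<longrightarrow> p I - (\<Sum>i\<in>I. w $ i) \<le> p I' - (\<Sum>i\<in>I'. w $ i))}"

definition cell :: "nat \<Rightarrow> ('n::finite set \<Rightarrow> real) \<Rightarrow> 'n set set \<Rightarrow> (real ^ 'n) set" where
  "cell d p M = {w. min_sets d p w = M}"

definition tls_faces :: "nat \<Rightarrow> ('n::finite set \<Rightarrow> real) \<Rightarrow> (real ^ 'n) set set" where
  "tls_faces d p =
    {closure (cell d p M) | M. cell d p M \<noteq> {} \<and> cell d p M \<subseteq> tropical_linear_space d p}"

text \<open>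
  Elements of the quotient of \<open>real ^ 'n\<close> by the line spanned by the all-ones vector are
  cosets, with the quotient norm.
\<close>

definition ones_coset :: "real ^ 'n \<Rightarrow> (real ^ 'n) set" where
  "ones_coset x = {x + t *\<^sub>R (\<chi> i. 1) | t. True}"

definition quotient_norm :: "(real ^ 'n::finite) set \<Rightarrow> real" where
  "quotient_norm C = Inf (norm ` C)"

definition bounded_mod_ones :: "(real ^ 'n::finite) set \<Rightarrow> bool" where
  "bounded_mod_ones F \<longleftrightarrow> (\<exists>B. \<forall>C \<in> ones_coset ` F. quotient_norm C \<le> B)"

definition bounded_faces_of_dim ::
    "nat \<Rightarrow> ('n::finite set \<Rightarrow> real) \<Rightarrow> nat \<Rightarrow> (real ^ 'n) set set" where
  "bounded_faces_of_dim d p k =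
    {F \<in> tls_faces d p. bounded_mod_ones F \<and> aff_dim F = int k}"

end

theory Submission imports Defs begin

text \<open>
  Let \<open>M\<close> be the set system of a bounded \<open>d\<close>-dimensional face. Points of \<open>L(p)\<close> have no loops,
  boundedness excludes coloops, so every component of \<open>M\<close> has at least two elements; the
  dimension is at most the number of components. Hence there are \<open>d\<close> components, all of rank
  one, and \<open>M\<close> consists of all transversals of a partition of \<open>[n]\<close> into \<open>d\<close> blocks of size at
  least two.

  If \<open>n = 2d\<close>, the complement of a transversal is a transversal, and \<open>e\<^sub>I + e\<^bsub>V-I\<^esub>\<close> is the
  all-ones vector. So the cells of the matroid subdivision dual to two such faces share an
  interior point (the barycentre of the hypersimplex), and therefore coincide.

  If \<open>n = 2d + 1\<close>, the partition has one triple \<open>T\<close> and otherwise pairs. Deleting \<open>v \<in> T\<close>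
  gives a perfect matching of \<open>[n] - v\<close>, which by the first case depends only on \<open>v\<close>. Inside a
  connected component of the hypergraph of triples, fix a vertex \<open>r\<close>: every triple of the
  component loses one vertex to become a pair of the matching missing \<open>r\<close>. These pairs are
  disjoint and avoid \<open>r\<close>, so there are at most \<open>(n - 1)/2 = d\<close> triples.
\<close>

section \<open>Partitions and their transversals\<close>

definition transversals :: "'a set \<Rightarrow> 'a set set \<Rightarrow> 'a set set" where
  "transversals V Q = {I. I \<subseteq> V \<and> (\<forall>C\<in>Q. card (I \<inter> C) = 1)}"

lemma partition_on_block_eq:
  assumes "partition_on V Q" "C \<in> Q" "D \<in> Q" "x \<in> C" "x \<in> D"
  shows "C = D"
  using assms partition_onD2[of V Q] by (auto simp: disjoint_def)

lemma sum_card_blocks: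
  fixes P :: "'n::finite set set"
  assumes P: "partition_on UNIV P"
  shows "(\<Sum>C\<in>P. card C) = CARD('n)"
  using partition_on_block_eq[OF P] partition_onD1[OF P]
  by (subst card_UN_disjoint[symmetric, of P "\<lambda>C. C"]) auto

lemma partition_on_Int:
  assumes "partition_on UNIV P" "\<And>C. C \<in> P \<Longrightarrow> V \<inter> C \<noteq> {}"
  shows "partition_on V ((\<inter>) V ` P)"
proof -
  have "(\<inter>) V ` P - {{}} = (\<inter>) V ` P"
    using assms(2) by auto
  then show ?thesis
    using partition_on_restrict[OF assms(1), of V] by simp
qed

lemma choice_image_transversal:
  assumes Q: "partition_on V Q" and f: "\<And>C. C \<in> Q \<Longrightarrow> f C \<in> C"
  shows "f ` Q \<in> transversals V Q"
proof -
  have "f ` Q \<inter> C = {f C}" if "C \<in> Q" for C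
    using that f partition_on_block_eq[OF Q] by blast
  moreover have "f ` Q \<subseteq> V"
    using f partition_onD1[OF Q] by blast
  ultimately show ?thesis
    by (simp add: transversals_def)
qed

lemma transversals_nonempty:
  assumes Q: "partition_on V Q"
  shows "transversals V Q \<noteq> {}"
proof -
  have "(SOME x. x \<in> C) \<in> C" if "C \<in> Q" for C
    using that partition_onD3[OF Q] by (metis some_in_eq)
  then show ?thesis
    using choice_image_transversal[OF Q, of "\<lambda>C. SOME x. x \<in> C"] by blast
qed

lemma card_transversal:
  fixes I :: "'n::finite set"
  assumes Q: "partition_on V Q" and I: "I \<in> transversals V Q"
  shows "card I = card Q"
proof -
  have "I = (\<Union>C\<in>Q. I \<inter> C)"
    using I partition_onD1[OF Q] by (auto simp: transversals_def)
  then have "card I = card (\<Union>C\<in>Q. I \<inter> C)"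
    by simp
  also have "\<dots> = (\<Sum>C\<in>Q. card (I \<inter> C))"
    using partition_on_block_eq[OF Q] by (intro card_UN_disjoint) auto
  also have "\<dots> = card Q"
    using I by (simp add: transversals_def)
  finally show ?thesis .
qed

text \<open>Transversals detect blocks: two distinct elements of \<open>V\<close> share a block
  exactly when no transversal contains both.\<close>

lemma subset_of_transversals_eq:
  fixes V :: "'n::finite set"
  assumes Q: "partition_on V Q" and Q': "partition_on V Q'"
    and eq: "transversals V Q = transversals V Q'"
    and C: "C \<in> Q"
  shows "C \<in> Q'"
proof -
  \<comment> \<open>Kept generic in the two partitions, because the blocks through \<open>a\<close>
    must be compared in both directions.\<close>
  have same: "b \<in> D'" if QQ: "partition_on V P" "partition_on V P'" "transversals V P = transversals V P'"
    "D \<in> P" "D' \<in> P'" "a \<in> D" "a \<in> D'" "b \<in> D" for P P' D D' a b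
  proof (rule ccontr)
    assume b: "b \<notin> D'"
    have "b \<in> V"
      using QQ partition_onD1 by blast
    then obtain E where E: "E \<in> P'" "b \<in> E"
      using QQ partition_onD1 by blast
    have "E \<noteq> D'"
      using E b by auto
    \<comment> \<open>As \<open>a\<close> and \<open>b\<close> lie in distinct blocks of
      \<open>P'\<close>, a choice function can pick both; its image would then meet \<open>D\<close>
      twice.\<close>
    define f where "f = (\<lambda>X. if X = D' then a else if X = E then b else SOME x. x \<in> X)"
    have "f X \<in> X" if "X \<in> P'" for X
    proof -
      have "(SOME x. x \<in> X) \<in> X"
        using that partition_onD3[OF QQ(2)] by (metis some_in_eq)
      then show ?thesis
        using E QQ by (simp add: f_def)
    qed
    then have "f ` P' \<in> transversals V P"
      using choice_image_transversal QQ by metis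
    then have 1: "card (f ` P' \<inter> D) = 1"
      using QQ by (auto simp: transversals_def)
    have "f D' = a" "f E = b"
      using \<open>E \<noteq> D'\<close> by (auto simp: f_def)
    then have "a \<in> f ` P' \<inter> D" "b \<in> f ` P' \<inter> D"
      using E QQ by force+
    moreover have "a \<noteq> b"
      using b QQ by auto
    ultimately show False
      using 1 by (metis card_1_singletonE singletonD)
  qed
  obtain a where a: "a \<in> C"
    using C partition_onD3[OF Q] by fastforce
  then have "a \<in> V"
    using C partition_onD1[OF Q] by blast
  then obtain D where D: "D \<in> Q'" "a \<in> D"
    using partition_onD1[OF Q'] by blast
  have "C = D"
    using same[OF Q Q' eq C D(1) a D(2)] same[OF Q' Q eq[symmetric] D(1) C D(2) a] by blast
  then show ?thesis
    using D by simp
qed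

lemma partition_eq_if_transversals_eq:
  fixes V :: "'n::finite set"
  assumes "partition_on V Q" "partition_on V Q'" "transversals V Q = transversals V Q'"
  shows "Q = Q'"
  using assms subset_of_transversals_eq by (metis subsetI subset_antisym)

section \<open>Counting triples by moving the hole of a matching\<close>

text \<open>By \<open>move\<close>, shifting the hole within a triple preserves all blocks but one.
  One partition per component thus contains a pair from each triple of that component; these pairs
  are disjoint and miss a vertex, whence the strict bound.\<close>

lemma moving_matching_triples:
  fixes \<T> :: "'n::finite set set" and Q :: "'n \<Rightarrow> 'n set set"
  assumes three: "\<And>T. T \<in> \<T> \<Longrightarrow> card T = 3"
    and part: "\<And>T v. T \<in> \<T> \<Longrightarrow> v \<in> T \<Longrightarrow> partition_on (- {v}) (Q v)"
    and pair: "\<And>T v. T \<in> \<T> \<Longrightarrow> v \<in> T \<Longrightarrow> T - {v} \<in> Q v"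
    and move: "\<And>T v v' C. T \<in> \<T> \<Longrightarrow> v \<in> T \<Longrightarrow> v' \<in> T \<Longrightarrow> C \<in> Q v \<Longrightarrow> C \<noteq> T - {v} \<Longrightarrow> C \<in> Q v'"
  shows "2 * card \<T> < CARD('n)"
proof (cases "\<T> = {}")
  case True
  then show ?thesis by simp
next
  case False
  \<comment> \<open>Removing a common vertex \<open>a\<close> leaves two blocks of
    \<open>Q a\<close> that both contain \<open>b\<close>.\<close>
  have share: "T = T'" if "T \<in> \<T>" "T' \<in> \<T>" "a \<in> T" "a \<in> T'" "b \<in> T" "b \<in> T'" "a \<noteq> b" for T T' a b
  proof -
    have "T - {a} = T' - {a}"
      using that by (intro partition_on_block_eq[OF part[of T a] pair pair, of T T' b]) auto
    then show ?thesis
      using that by blast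
  qed
  define E where "E = {(v, v'). \<exists>T\<in>\<T>. v \<in> T \<and> v' \<in> T}"
  have "sym E"
    by (auto simp: E_def sym_def)
  then have symE: "sym (E\<^sup>*)"
    by (rule sym_rtrancl)
  text \<open>Moving the hole of the matching from \<open>v\<close> to \<open>v'\<close> inside a triple only changes the pair lying in that triple.\<close>
  have walk: "(\<exists>T'\<in>\<T>. v' \<in> T') \<and> (\<exists>i\<in>T. T - {i} \<in> Q v')"
    if "(v, v') \<in> E\<^sup>*" "T \<in> \<T>" "v \<in> T" for v v' T
    using that
  proof (induction rule: rtrancl_induct)
    case base
    then show ?case
      using pair by blast
  next
    case (step y z)
    then obtain i where i: "i \<in> T" "T - {i} \<in> Q y"
      by blast
    obtain S where S: "S \<in> \<T>" "y \<in> S" "z \<in> S"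
      using step.hyps(2) by (auto simp: E_def)
    show ?case
    \<comment> \<open>The only block that \<open>move\<close> may destroy is \<open>S - {y}\<close>.
      If it is the pair of \<open>T\<close>, then \<open>S\<close> and \<open>T\<close> share two
      vertices and coincide, so \<open>pair\<close> supplies the new block.\<close>
    proof (cases "T - {i} = S - {y}")
      case True
      have "card (T - {i}) = 2"
        using three[of T] step.prems i by simp
      then obtain a b where "a \<noteq> b" "T - {i} = {a, b}"
        by (meson card_2_iff)
      then have "a \<in> T" "b \<in> T" "a \<in> S" "b \<in> S"
        using True by blast+
      then have "S = T"
        using share[of S T a b] S step.prems \<open>a \<noteq> b\<close> by blast
      then show ?thesis
        using S pair by blast
    next
      case False
      then show ?thesis
        using move[OF S i(2)] S i by blast
    qed
  qed
  \<comment> \<open>Connected vertices reach the same set, so the choice gives one root per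
    component.\<close>
  define r where "r = (\<lambda>v. SOME u. (v, u) \<in> E\<^sup>*)"
  have r: "(v, r v) \<in> E\<^sup>*" for v
    unfolding r_def by (rule someI[of _ v]) simp
  have r_eq: "r v = r u" if "(v, u) \<in> E\<^sup>*" for v u
  proof -
    have "(v, x) \<in> E\<^sup>* \<longleftrightarrow> (u, x) \<in> E\<^sup>*" for x
      using that symE by (meson rtrancl_trans symD)
    then show ?thesis
      by (simp add: r_def)
  qed
  have inT: "r v = r u" if "T \<in> \<T>" "v \<in> T" "u \<in> T" for v u T
    using that by (intro r_eq r_into_rtrancl) (auto simp: E_def)
  have "\<exists>i\<in>T. \<forall>v\<in>T. T - {i} \<in> Q (r v)" if T: "T \<in> \<T>" for T
  proof -
    obtain v where v: "v \<in> T"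
      using three[OF T] by fastforce
    then show ?thesis
      using walk[OF r T v] inT[OF T _ v] by metis
  qed
  then obtain i where i: "\<And>T. T \<in> \<T> \<Longrightarrow> i T \<in> T"
    "\<And>T v. T \<in> \<T> \<Longrightarrow> v \<in> T \<Longrightarrow> T - {i T} \<in> Q (r v)"
    by metis
  have partr: "partition_on (- {r v}) (Q (r v))" if "T \<in> \<T>" "v \<in> T" for T v
    using walk[OF r that] part by blast
  define h where "h = (\<lambda>T. T - {i T})"
  have card_h: "card (h T) = 2" if "T \<in> \<T>" for T
    using three[OF that] i(1)[OF that] by (simp add: h_def)
  \<comment> \<open>A common vertex \<open>x\<close> puts both triples in one component, so both
    pairs are blocks of the single partition \<open>Q (r x)\<close>.\<close>
  have disj: "T = T'" if T: "T \<in> \<T>" "T' \<in> \<T>" "x \<in> h T" "x \<in> h T'" for T T' x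
  proof -
    have x: "x \<in> T" "x \<in> T'"
      using T by (auto simp: h_def)
    have "h T = h T'"
      using i(2) T x by (intro partition_on_block_eq[OF partr[OF T(1) x(1)], of _ _ x]) (auto simp: h_def)
    moreover obtain a b where "a \<noteq> b" "h T = {a, b}"
      using card_h[OF T(1)] by (meson card_2_iff)
    ultimately have "a \<in> T" "b \<in> T" "a \<in> T'" "b \<in> T'"
      unfolding h_def by blast+
    then show ?thesis
      using share T \<open>a \<noteq> b\<close> by blast
  qed
  obtain T0 v0 where T0: "T0 \<in> \<T>" "v0 \<in> T0"
    using False three by (metis all_not_in_conv card.empty zero_neq_numeral)
  \<comment> \<open>A triple through the root \<open>r v0\<close> has it as its own root, so its
    pair is a block of a partition of the complement of \<open>r v0\<close>.\<close>
  have "r v0 \<notin> h T" if T: "T \<in> \<T>" for T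
  proof
    assume x: "r v0 \<in> h T"
    then have xT: "r v0 \<in> T"
      by (simp add: h_def)
    have rr: "r (r v0) = r v0"
      using r_eq[OF r] by metis
    have "h T \<in> Q (r v0)"
      using i(2)[OF T xT] rr by (simp add: h_def)
    then have "h T \<subseteq> - {r v0}"
      using partr[OF T0] partition_onD1 by blast
    then show False
      using x by blast
  qed
  then have "(\<Union>T\<in>\<T>. h T) \<subset> UNIV"
    by blast
  then have "card (\<Union>T\<in>\<T>. h T) < CARD('n)"
    by (simp add: psubset_card_mono)
  moreover have "card (\<Union>T\<in>\<T>. h T) = (\<Sum>T\<in>\<T>. card (h T))"
    using disj by (intro card_UN_disjoint) auto
  ultimately show ?thesis
    using card_h by simp
qed

section \<open>Minimising sets: exchange, coloops and complements\<close>

lemma min_sets_nonempty: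
  assumes "d \<le> CARD('n)"
  shows "min_sets d p (w :: real ^ 'n::finite) \<noteq> {}"
proof -
  let ?g = "\<lambda>I. p I - (\<Sum>i\<in>I. w $ i)"
  let ?A = "{I :: 'n set. card I = d}"
  have ne: "?A \<noteq> {}"
    using obtain_subset_with_card_n[OF assms] by blast
  have "finite (?g ` ?A)" by simp
  then have "Min (?g ` ?A) \<in> ?g ` ?A"
    using ne by (intro Min_in) auto
  then obtain I where I: "card I = d" "?g I = Min (?g ` ?A)"
    by auto
  have "?g I \<le> ?g I'" if "card I' = d" for I'
    unfolding I(2) using that by (intro Min_le) auto
  then show ?thesis
    using I by (auto simp: min_sets_def)
qed

text \<open>For \<open>J = insert i I\<close>, the terms of the condition on \<open>J\<close> are
  the minimised values at \<open>J - {j}\<close> plus the constant sum of \<open>w\<close> over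
  \<open>J\<close>. A minimum attained twice provides some \<open>j\<close> other than
  \<open>i\<close> that does at least as well as \<open>I\<close>.\<close>

lemma min_sets_exchange:
  fixes w :: "real ^ 'n::finite"
  assumes w: "w \<in> tropical_linear_space d p" and I: "I \<in> min_sets d p w" and i: "i \<notin> I"
  shows "\<exists>j\<in>I. insert i I - {j} \<in> min_sets d p w"
proof -
  define J where "J = insert i I"
  have card: "card J = d + 1"
    using I i by (simp add: J_def min_sets_def)
  let ?g = "\<lambda>j. p (J - {j}) + w $ j"
  let ?A = "{a \<in> J. \<forall>b\<in>J. ?g a \<le> ?g b}"
  have "2 \<le> card ?A"
    using w card by (simp add: tropical_linear_space_def min_attained_twice_def)
  then have "\<not> ?A \<subseteq> {i}"
    using card_mono[of "{i}" ?A] by auto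
  then obtain j where j: "j \<in> J" "j \<noteq> i" "?g j \<le> ?g i"
    using J_def by auto
  have "J - {i} = I"
    using i by (simp add: J_def)
  have s: "(\<Sum>k\<in>J - {x}. w $ k) = (\<Sum>k\<in>J. w $ k) - w $ x" if "x \<in> J" for x
    using that by (simp add: sum_diff1)
  have "card (J - {j}) = d"
    using card j by simp
  moreover have "p (J - {j}) - (\<Sum>k\<in>J - {j}. w $ k) \<le> p I - (\<Sum>k\<in>I. w $ k)"
    using j s[of j] s[of i] \<open>J - {i} = I\<close> by (simp add: J_def)
  ultimately have "J - {j} \<in> min_sets d p w"
    using I unfolding min_sets_def by (auto intro: order_trans)
  then show ?thesis
    using j by (auto simp: J_def)
qed

text \<open>Raising \<open>w $ i\<close> lowers all current minimisers equally and lowers no other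
  set by more, so a whole ray stays in the cell. The difference of coordinates \<open>i\<close> and
  \<open>k\<close> is invariant modulo the all-ones vector and grows along the ray.\<close>

lemma coloop_imp_unbounded:
  fixes w :: "real ^ 'n::finite"
  assumes ne: "min_sets d p w \<noteq> {}" and coloop: "\<And>I. I \<in> min_sets d p w \<Longrightarrow> i \<in> I" and k: "k \<noteq> i"
  shows "\<not> bounded_mod_ones (closure (cell d p (min_sets d p w)))"
proof
  assume "bounded_mod_ones (closure (cell d p (min_sets d p w)))"
  then obtain B where B: "\<And>x. x \<in> closure (cell d p (min_sets d p w)) \<Longrightarrow> quotient_norm (ones_coset x) \<le> B"
    by (auto simp: bounded_mod_ones_def)
  \<comment> \<open>Makes the coordinate difference at least \<open>2 * B + 1\<close>, so one of the
    two coordinates has absolute value at least \<open>B + 1 / 2\<close>.\<close>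
  define t where "t = max 0 (2 * B - w $ i + w $ k + 1)"
  define x where "x = w + axis i t"
  have t: "t \<ge> 0" "w $ i - w $ k + t \<ge> 2 * B + 1"
    by (auto simp: t_def)
  have sum_x: "(\<Sum>j\<in>I. x $ j) = (\<Sum>j\<in>I. w $ j) + (if i \<in> I then t else 0)" for I
    by (simp add: x_def sum.distrib axis_def)
  have "I \<in> min_sets d p x \<longleftrightarrow> I \<in> min_sets d p w" for I
  proof
    assume I: "I \<in> min_sets d p w"
    have "p I - (\<Sum>j\<in>I. x $ j) \<le> p I' - (\<Sum>j\<in>I'. x $ j)" if "card I' = d" for I'
    proof -
      have "p I - (\<Sum>j\<in>I. w $ j) \<le> p I' - (\<Sum>j\<in>I'. w $ j)"
        using I that by (simp add: min_sets_def)
      then show ?thesis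
        using coloop[OF I] t unfolding sum_x by auto
    qed
    then show "I \<in> min_sets d p x"
      using I by (simp add: min_sets_def)
  next
    assume I: "I \<in> min_sets d p x"
    obtain I0 where I0: "I0 \<in> min_sets d p w"
      using ne by blast
    have "p I - (\<Sum>j\<in>I. x $ j) \<le> p I0 - (\<Sum>j\<in>I0. x $ j)"
      using I I0 by (simp add: min_sets_def)
    then have "p I - (\<Sum>j\<in>I. w $ j) \<le> p I0 - (\<Sum>j\<in>I0. w $ j)"
      using coloop[OF I0] t unfolding sum_x by (auto split: if_splits)
    then show "I \<in> min_sets d p w"
      using I I0 unfolding min_sets_def by (auto intro: order_trans)
  qed
  then have "x \<in> cell d p (min_sets d p w)"
    by (auto simp: cell_def)
  then have le: "quotient_norm (ones_coset x) \<le> B"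
    using B closure_subset by blast
  have "B + 1 / 2 \<le> norm y" if "y \<in> ones_coset x" for y
  proof -
    have "y $ i - y $ k = x $ i - x $ k"
      using that by (auto simp: ones_coset_def)
    also have "\<dots> = w $ i - w $ k + t"
      using k by (simp add: x_def axis_def)
    finally show ?thesis
      using t component_le_norm_cart[of y i] component_le_norm_cart[of y k] by linarith
  qed
  moreover have "ones_coset x \<noteq> {}"
    by (auto simp: ones_coset_def)
  ultimately have "B + 1 / 2 \<le> quotient_norm (ones_coset x)"
    unfolding quotient_norm_def by (intro cINF_greatest) auto
  then show False
    using le by simp
qed

text \<open>The indicators of \<open>I\<close> and \<open>V - I\<close> have the same sum as those
  of \<open>J\<close> and \<open>V - J\<close>, so linear terms cancel over each pair. Minimality at
  \<open>w'\<close> bounds \<open>p J + p (V - J)\<close> by \<open>p I + p (V - I)\<close>, and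
  minimality at \<open>w\<close> then forces \<open>J\<close> to tie with \<open>I\<close>.\<close>

lemma complementary_min_sets:
  fixes w w' :: "real ^ 'n::finite"
  assumes I: "I \<in> min_sets d p w" "V - I \<in> min_sets d p w" "I \<subseteq> V"
    and J: "J \<in> min_sets d p w'" "V - J \<in> min_sets d p w'" "J \<subseteq> V"
  shows "J \<in> min_sets d p w"
proof -
  have s: "(\<Sum>k\<in>V - X. u $ k) = (\<Sum>k\<in>V. u $ k) - (\<Sum>k\<in>X. u $ k)" if "X \<subseteq> V" for X and u :: "real ^ 'n"
    using that by (simp add: sum_diff)
  have card: "card I = d" "card (V - I) = d" "card J = d" "card (V - J) = d"
    using I J by (auto simp: min_sets_def)
  have le: "p I - (\<Sum>k\<in>I. w $ k) \<le> p X - (\<Sum>k\<in>X. w $ k)"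
    "p (V - I) - (\<Sum>k\<in>V - I. w $ k) \<le> p X - (\<Sum>k\<in>X. w $ k)"
    "p J - (\<Sum>k\<in>J. w' $ k) \<le> p X - (\<Sum>k\<in>X. w' $ k)"
    "p (V - J) - (\<Sum>k\<in>V - J. w' $ k) \<le> p X - (\<Sum>k\<in>X. w' $ k)" if "card X = d" for X
    using I J that by (auto simp: min_sets_def)
  have "p J - (\<Sum>k\<in>J. w $ k) \<le> p I - (\<Sum>k\<in>I. w $ k)"
    using le(2)[OF card(4)] le(3)[OF card(1)] le(4)[OF card(2)]
    unfolding s[OF I(3)] s[OF J(3)] by linarith
  then show ?thesis
    using I(1) card(3) unfolding min_sets_def by (auto intro: order_trans)
qed

text \<open>When all blocks meet \<open>V\<close> in pairs, the transversals inside \<open>V\<close>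
  are closed under complement in \<open>V\<close>. The preceding exchange of minimisers makes these
  transversals the same for \<open>P\<close> and \<open>P'\<close>, and they determine the traces of
  the blocks on \<open>V\<close>.\<close>

lemma pairs_unique:
  fixes w w' :: "real ^ 'n::finite"
  assumes P: "partition_on UNIV P" "min_sets d p w = transversals UNIV P" "\<And>C. C \<in> P \<Longrightarrow> card (V \<inter> C) = 2"
    and P': "partition_on UNIV P'" "min_sets d p w' = transversals UNIV P'" "\<And>C. C \<in> P' \<Longrightarrow> card (V \<inter> C) = 2"
  shows "(\<inter>) V ` P = (\<inter>) V ` P'"
proof -
  have part: "partition_on V ((\<inter>) V ` R)" if R: "partition_on UNIV R" "\<And>C. C \<in> R \<Longrightarrow> card (V \<inter> C) = 2" for R
    using R(2) by (intro partition_on_Int[OF R(1)]) fastforce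
  have trans: "transversals V ((\<inter>) V ` R) = {I \<in> transversals UNIV R. I \<subseteq> V}" for R :: "'n set set"
  proof -
    have "I \<inter> (V \<inter> C) = I \<inter> C" if "I \<subseteq> V" for I C
      using that by blast
    then show ?thesis
      by (auto simp: transversals_def)
  qed
  have compl: "V - I \<in> transversals UNIV R"
    if "\<And>C. C \<in> R \<Longrightarrow> card (V \<inter> C) = 2" "I \<in> transversals UNIV R" "I \<subseteq> V" for R I
  proof -
    have "card ((V - I) \<inter> C) = 1" if C: "C \<in> R" for C
    proof -
      have "(V - I) \<inter> C = (V \<inter> C) - (I \<inter> C)" by blast
      moreover have "I \<inter> C \<subseteq> V \<inter> C" using \<open>I \<subseteq> V\<close> by blast
      ultimately have "card ((V - I) \<inter> C) = card (V \<inter> C) - card (I \<inter> C)"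
        by (simp add: card_Diff_subset)
      then show ?thesis
        using that \<open>\<And>C. C \<in> R \<Longrightarrow> card (V \<inter> C) = 2\<close>[OF C] \<open>I \<in> _\<close> by (simp add: transversals_def)
    qed
    then show ?thesis
      by (simp add: transversals_def)
  qed
  obtain I where I: "I \<in> transversals UNIV P" "I \<subseteq> V"
    using transversals_nonempty[OF part[OF P(1,3)]] unfolding trans by blast
  obtain I' where I': "I' \<in> transversals UNIV P'" "I' \<subseteq> V"
    using transversals_nonempty[OF part[OF P'(1,3)]] unfolding trans by blast
  have "J \<in> transversals UNIV P" if "J \<in> transversals UNIV P'" "J \<subseteq> V" for J
    using complementary_min_sets[of I d p w V J w'] compl[OF P(3)] compl[OF P'(3)] that I
    unfolding P(2) P'(2) by blast
  moreover have "J \<in> transversals UNIV P'" if "J \<in> transversals UNIV P" "J \<subseteq> V" for J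
    using complementary_min_sets[of I' d p w' V J w] compl[OF P(3)] compl[OF P'(3)] that I'
    unfolding P(2) P'(2) by blast
  ultimately have "transversals V ((\<inter>) V ` P) = transversals V ((\<inter>) V ` P')"
    unfolding trans by blast
  then show ?thesis
    by (intro partition_eq_if_transversals_eq[OF part[OF P(1,3)] part[OF P'(1,3)]])
qed

section \<open>From bounded faces of full dimension to partitions\<close>

lemma dim_constant_on_blocks:
  fixes P :: "'n::finite set set"
  assumes P: "partition_on UNIV P"
  shows "dim {u :: real ^ 'n. \<forall>C\<in>P. \<forall>i\<in>C. \<forall>j\<in>C. u $ i = u $ j} \<le> card P"
proof -
  define ind :: "'n set \<Rightarrow> real ^ 'n" where "ind = (\<lambda>C. \<chi> i. if i \<in> C then 1 else 0)"
  have "u \<in> span (ind ` P)" if u: "\<forall>C\<in>P. \<forall>i\<in>C. \<forall>j\<in>C. u $ i = u $ j" for u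
  proof -
    define r where "r = (\<lambda>C::'n set. SOME i. i \<in> C)"
    have "u = (\<Sum>C\<in>P. u $ r C *\<^sub>R ind C)"
    proof (rule vec_eq_iff[THEN iffD2], rule allI)
      fix i
      obtain D where D: "D \<in> P" "i \<in> D"
        using partition_onD1[OF P] by blast
      have "r D \<in> D"
        unfolding r_def using D by (rule_tac someI)
      have "(\<Sum>C\<in>P. u $ r C *\<^sub>R ind C) $ i = (\<Sum>C\<in>P. if C = D then u $ r D else 0)"
        unfolding sum_component
      proof (rule sum.cong)
        fix C assume "C \<in> P"
        then have "i \<in> C \<longleftrightarrow> C = D"
          using D partition_on_block_eq[OF P] by blast
        then show "(u $ r C *\<^sub>R ind C) $ i = (if C = D then u $ r D else 0)"
          by (auto simp: ind_def)
      qed simp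
      also have "\<dots> = u $ r D"
        using D by simp
      also have "\<dots> = u $ i"
        using u D \<open>r D \<in> D\<close> by blast
      finally show "u $ i = (\<Sum>C\<in>P. u $ r C *\<^sub>R ind C) $ i" ..
    qed
    also have "\<dots> \<in> span (ind ` P)"
      by (intro span_sum span_scale span_base) auto
    finally show ?thesis .
  qed
  then have "dim {u :: real ^ 'n. \<forall>C\<in>P. \<forall>i\<in>C. \<forall>j\<in>C. u $ i = u $ j} \<le> card (ind ` P)"
    by (intro dim_le_card) auto
  also have "\<dots> \<le> card P"
    by (simp add: card_image_le)
  finally show ?thesis .
qed

lemma bounded_face_partition:
  fixes p :: "'n::finite set \<Rightarrow> real"
  assumes F: "F \<in> bounded_faces_of_dim d p d" and n: "d < CARD('n)" "CARD('n) \<le> 2 * d + 1"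
  shows "\<exists>w P. F = closure (cell d p (transversals UNIV P)) \<and> min_sets d p w = transversals UNIV P \<and>
    partition_on UNIV P \<and> card P = d \<and> (\<forall>C\<in>P. 2 \<le> card C)"
proof -
  obtain M where M: "F = closure (cell d p M)" "cell d p M \<noteq> {}" "cell d p M \<subseteq> tropical_linear_space d p"
    and bdd: "bounded_mod_ones F" and dimF: "aff_dim F = int d"
    using F unfolding bounded_faces_of_dim_def tls_faces_def by blast
  define K where "K = cell d p M"
  obtain w where wK: "w \<in> K"
    using M K_def by blast
  have Mw: "min_sets d p v = M" if "v \<in> K" for v
    using that by (simp add: K_def cell_def)
  have cardM: "card I = d" if "I \<in> M" for I
    using that Mw[OF wK] by (auto simp: min_sets_def)
  have neM: "M \<noteq> {}"
    using min_sets_nonempty[of d p w] n Mw[OF wK] by simp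
  have exch: "\<exists>j\<in>I. insert i I - {j} \<in> M" if "I \<in> M" "i \<notin> I" for i I
    using min_sets_exchange[of w d p I i] that Mw[OF wK] M(3) wK K_def by blast
  have nocoloop: "\<exists>I\<in>M. i \<notin> I" for i
  proof (rule ccontr)
    assume con: "\<not> (\<exists>I\<in>M. i \<notin> I)"
    then obtain I where "I \<in> M" "i \<in> I"
      using neM by blast
    \<comment> \<open>Together with \<open>d < CARD('n)\<close> this yields a second coordinate
      \<open>k\<close> to compare with \<open>i\<close>.\<close>
    then have "d > 0"
      using cardM by (metis card_gt_0_iff empty_iff finite)
    then have "UNIV \<noteq> {i}"
      using n by (metis One_nat_def card.empty card.insert finite.emptyI empty_iff less_one not_less_eq less_nat_zero_code nat_neq_iff)
    then obtain k where "k \<noteq> i"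
      by blast
    then show False
      using coloop_imp_unbounded[of d p w i k] con bdd neM M(1) unfolding Mw[OF wK] by blast
  qed
  \<comment> \<open>All members of \<open>M\<close> tie at \<open>v\<close> and at \<open>w\<close>;
    subtracting the two ties cancels \<open>p\<close>.\<close>
  have diff: "(\<Sum>i\<in>I. (v - w) $ i) = (\<Sum>i\<in>I'. (v - w) $ i)" if "I \<in> M" "I' \<in> M" "v \<in> K" for I I' v
  proof -
    have "p I - (\<Sum>i\<in>I. u $ i) = p I' - (\<Sum>i\<in>I'. u $ i)" if "u \<in> K" for u
      using Mw[OF that] \<open>I \<in> M\<close> \<open>I' \<in> M\<close> cardM unfolding min_sets_def by (auto intro: antisym)
    from this[OF wK] this[OF \<open>v \<in> K\<close>] show ?thesis
      by (simp add: sum_subtractf)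
  qed
  text \<open>These are the connected components of the matroid \<open>M\<close>.\<close>
  define R where "R = {(i, j). \<forall>v\<in>K. (v - w) $ i = (v - w) $ j}"
  define P where "P = UNIV // R"
  have "equiv UNIV R"
    by (rule equivI) (auto simp: R_def refl_on_def sym_def trans_def)
  then have P: "partition_on UNIV P"
    unfolding P_def by (rule partition_on_quotient)
  have R_iff: "(i, j) \<in> R" if "C \<in> P" "i \<in> C" "j \<in> C" for C i j
    using that \<open>equiv UNIV R\<close> unfolding P_def by (meson quotient_eq_iff)
  have R_P: "j \<in> C" if "C \<in> P" "i \<in> C" "(i, j) \<in> R" for C i j
    using that \<open>equiv UNIV R\<close> unfolding P_def by (meson in_quotient_imp_closed)
  \<comment> \<open>Comparing the sums of \<open>v - w\<close> over \<open>I\<close> and over the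
    exchanged set shows that \<open>i\<close> and \<open>j\<close> have equal coordinates: exchanges
    stay within a block.\<close>
  have exchR: "\<exists>j\<in>I. (i, j) \<in> R \<and> insert i I - {j} \<in> M" if I: "I \<in> M" "i \<notin> I" for i I
  proof -
    obtain j where j: "j \<in> I" "insert i I - {j} \<in> M"
      using exch I by blast
    have "(v - w) $ i = (v - w) $ j" if "v \<in> K" for v
    proof -
      have "insert i I - {j} = insert i (I - {j})" "i \<notin> I - {j}"
        using j I by auto
      then have "(\<Sum>k\<in>insert i I - {j}. (v - w) $ k) = (v - w) $ i + ((\<Sum>k\<in>I. (v - w) $ k) - (v - w) $ j)"
        using j by (simp add: sum_diff1)
      then show ?thesis
        using diff[OF I(1) j(2) that] by simp
    qed
    then show ?thesis
      using j by (auto simp: R_def)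
  qed
  have two: "2 \<le> card C" if C: "C \<in> P" for C
  proof -
    obtain i where i: "i \<in> C"
      using C partition_onD3[OF P] by fastforce
    obtain I where I: "I \<in> M" "i \<notin> I"
      using nocoloop by blast
    then obtain j where j: "j \<in> I" "(i, j) \<in> R"
      using exchR by blast
    then have "{i, j} \<subseteq> C" "i \<noteq> j"
      using R_P[OF C i] i I by auto
    then show ?thesis
      using card_mono[of C "{i, j}"] by simp
  qed
  have "2 * card P \<le> CARD('n)"
    using sum_mono[of P "\<lambda>_. 2" card] two sum_card_blocks[OF P] by simp
  then have Pd: "card P \<le> d"
    using n by linarith
  \<comment> \<open>The directions \<open>D\<close> of the cell have dimension \<open>d\<close> but
    lie in \<open>U\<close>, of dimension at most \<open>card P\<close>, itself at most
    \<open>d\<close>. Equality follows throughout, and \<open>D\<close> spans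
    \<open>U\<close>.\<close>
  define D where "D = (+) (- w) ` K"
  define U where "U = {u :: real ^ 'n. \<forall>C\<in>P. \<forall>i\<in>C. \<forall>j\<in>C. u $ i = u $ j}"
  have "aff_dim K = int (dim D)"
    unfolding D_def using wK by (intro aff_dim_eq_dim hull_inc)
  then have dimD: "dim D = d"
    using dimF M(1) by (simp add: K_def)
  have "D \<subseteq> U"
  proof
    fix u assume "u \<in> D"
    then obtain v where v: "v \<in> K" "u = v - w"
      by (auto simp: D_def)
    have "u $ i = u $ j" if "C \<in> P" "i \<in> C" "j \<in> C" for C i j
      using R_iff[OF that] v unfolding R_def by blast
    then show "u \<in> U"
      unfolding U_def by blast
  qed
  have dimU: "dim U \<le> card P"
    unfolding U_def by (rule dim_constant_on_blocks[OF P])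
  have "dim D \<le> dim U"
    using \<open>D \<subseteq> U\<close> by (rule dim_subset)
  then have Pd': "card P = d" "dim U \<le> dim D"
    using Pd dimD dimU by auto
  have "span D = span U"
    using \<open>D \<subseteq> U\<close> Pd'(2) by (rule dim_eq_span)
  \<comment> \<open>Equality of the sums over \<open>I\<close> and \<open>I'\<close> is a linear
    condition that holds on \<open>D\<close>, hence on its span, which contains the indicator of
    \<open>C\<close>.\<close>
  have block: "card (I \<inter> C) = card (I' \<inter> C)" if "I \<in> M" "I' \<in> M" "C \<in> P" for I I' C
  proof -
    let ?c = "\<chi> i. if i \<in> C then 1 else (0::real)"
    let ?S = "{u :: real ^ 'n. (\<Sum>i\<in>I. u $ i) = (\<Sum>i\<in>I'. u $ i)}"
    have "subspace ?S"
      by (auto simp: subspace_def sum.distrib simp flip: sum_distrib_left)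
    moreover have "D \<subseteq> ?S"
      using diff[OF that(1,2)] by (auto simp: D_def)
    ultimately have "span D \<subseteq> ?S"
      by (simp add: span_minimal)
    moreover have "?c \<in> U"
      using that partition_on_block_eq[OF P] by (auto simp: U_def)
    ultimately have "?c \<in> ?S"
      using \<open>span D = span U\<close> span_base by blast
    then show ?thesis
      by (simp add: sum.If_cases)
  qed
  have cardI: "(\<Sum>C\<in>P. card (I \<inter> C)) = d" if "I \<in> M" for I
  proof -
    have "(\<Sum>C\<in>P. card (I \<inter> C)) = card (\<Union>C\<in>P. I \<inter> C)"
      using partition_on_block_eq[OF P] by (intro card_UN_disjoint[symmetric]) auto
    also have "(\<Union>C\<in>P. I \<inter> C) = I"
      using partition_onD1[OF P] by blast
    finally show ?thesis
      using cardM[OF that] by simp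
  qed
  have pos: "1 \<le> card (I \<inter> C)" if I: "I \<in> M" and C: "C \<in> P" for I C
  proof -
    obtain i where i: "i \<in> C"
      using C partition_onD3[OF P] by fastforce
    obtain I' where I': "I' \<in> M" "i \<notin> I'"
      using nocoloop by blast
    then obtain j where "j \<in> I'" "(i, j) \<in> R"
      using exchR by blast
    then have "I' \<inter> C \<noteq> {}"
      using R_P[OF C i] by blast
    then have "0 < card (I' \<inter> C)"
      by (simp add: card_gt_0_iff)
    then show ?thesis
      using block[OF I I'(1) C] by simp
  qed
  have one: "card (I \<inter> C) = 1" if I: "I \<in> M" and C: "C \<in> P" for I C
  proof (rule ccontr)
    assume "card (I \<inter> C) \<noteq> 1"
    then have "(\<Sum>C\<in>P. 1) < (\<Sum>C\<in>P. card (I \<inter> C))"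
      using pos[OF I] C by (intro sum_strict_mono_ex1) (auto intro!: bexI[of _ C] simp: order_neq_le_trans)
    then show False
      using cardI[OF I] Pd' by simp
  qed
  \<comment> \<open>Bring the elements of \<open>J\<close> into \<open>I\<close> one at a time. Each
    exchange discards an element from the block of the new one, which is never an element of
    \<open>J\<close>.\<close>
  have "J \<in> M" if J: "J \<in> transversals UNIV P" for J
  proof -
    have cJ: "card J = d"
      using card_transversal[OF P J] Pd' by simp
    have "J \<in> M" if "I \<in> M" for I
      using that
    proof (induction "card (J - I)" arbitrary: I rule: less_induct)
      case less
      show ?case
      proof (cases "J \<subseteq> I")
        case True
        then have "J = I"
          using cJ cardM[OF less.prems] by (simp add: card_subset_eq)
        then show ?thesis
          using less.prems by simp
      next
        case False
        then obtain b where b: "b \<in> J" "b \<notin> I"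
          by blast
        obtain a where a: "a \<in> I" "(b, a) \<in> R" "insert b I - {a} \<in> M"
          using exchR[OF less.prems b(2)] by blast
        obtain C where C: "C \<in> P" "b \<in> C"
          using partition_onD1[OF P] by blast
        have "a \<in> C"
          using R_P[OF C a(2)] .
        moreover have "card (J \<inter> C) = 1"
          using J C by (simp add: transversals_def)
        ultimately have "a \<notin> J"
          using a b C by (metis IntI card_1_singletonE singletonD)
        then have "J - (insert b I - {a}) \<subset> J - I"
          using a b by blast
        then have "card (J - (insert b I - {a})) < card (J - I)"
          by (simp add: psubset_card_mono)
        then show ?thesis
          using less.hyps a(3) by blast
      qed
    qed
    then show ?thesis
      using neM by blast
  qed
  then have "M = transversals UNIV P"
    using one by (auto simp: transversals_def)
  then show ?thesis
    using M(1) Mw[OF wK] P Pd' two by blast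
qed


section \<open>Counting the partitions\<close>

theorem mainTheorem4:
  fixes d n :: nat and p :: "'n::finite set \<Rightarrow> real"
  assumes "CARD('n) = n"
    and "n = 2 * d \<or> n = 2 * d + 1"
    and "tropical_pluecker_vector d p"
  shows "finite (bounded_faces_of_dim d p d) \<and>
    (n = 2 * d \<longrightarrow> card (bounded_faces_of_dim d p d) \<le> 1) \<and>
    (n = 2 * d + 1 \<longrightarrow> card (bounded_faces_of_dim d p d) \<le> d)"
proof -
  define \<P> where "\<P> = {P :: 'n set set. partition_on UNIV P \<and> card P = d \<and> (\<forall>C\<in>P. 2 \<le> card C) \<and>
    (\<exists>w. min_sets d p w = transversals UNIV P)}"
  \<comment> \<open>Excludes \<open>n = 0\<close>, the only case in which \<open>d < n\<close> could
    fail.\<close>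
  have "0 < CARD('n)" by simp
  then have n: "d < CARD('n)" "CARD('n) \<le> 2 * d + 1"
    using assms by linarith+
  have faces: "bounded_faces_of_dim d p d \<subseteq> (\<lambda>P. closure (cell d p (transversals UNIV P))) ` \<P>"
    using bounded_face_partition[OF _ n, of _ p] unfolding \<P>_def by blast
  have "finite \<P>" by simp
  then have fin: "finite (bounded_faces_of_dim d p d)"
    and le: "card (bounded_faces_of_dim d p d) \<le> card \<P>"
    using faces by (rule finite_surj, rule surj_card_le)
  have P: "partition_on UNIV P" "finite P" if "P \<in> \<P>" for P
    using that by (auto simp: \<P>_def)
  \<comment> \<open>Truncated subtraction is exact here, since every block has at least two
    elements.\<close>
  have excess: "(\<Sum>C\<in>P. card C - 2) = n - 2 * d" if "P \<in> \<P>" for P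
    using that sum_card_blocks[OF P(1)[OF that]] assms(1) unfolding \<P>_def
    by (subst sum_subtractf_nat) auto
  have unique: "(\<inter>) V ` P = (\<inter>) V ` P'"
    if "P \<in> \<P>" "P' \<in> \<P>" "\<And>C. C \<in> P \<Longrightarrow> card (V \<inter> C) = 2" "\<And>C. C \<in> P' \<Longrightarrow> card (V \<inter> C) = 2"
    for P P' V
    using that pairs_unique[of P d p _ V P'] unfolding \<P>_def by blast
  have even: "card \<P> \<le> 1" if "n = 2 * d"
  proof -
    have "card C = 2" if "P \<in> \<P>" "C \<in> P" for P C
    proof -
      have "card C - 2 = 0"
        using excess[OF that(1)] \<open>n = 2 * d\<close> that P(2)[OF that(1)] by simp
      then show ?thesis
        using that by (auto simp: \<P>_def intro: antisym)
    qed
    then have "P = P'" if "P \<in> \<P>" "P' \<in> \<P>" for P P'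
      using unique[OF that, of UNIV] that by simp
    then show ?thesis
      by (simp add: card_le_Suc0_iff_eq)
  qed
  have odd: "card \<P> \<le> d" if n: "n = 2 * d + 1"
  proof -
    \<comment> \<open>The total excess over pairs is one, so a single block carries it.\<close>
    have "\<exists>T\<in>P. card T = 3 \<and> (\<forall>C\<in>P. C \<noteq> T \<longrightarrow> card C = 2)" if PP: "P \<in> \<P>" for P
    proof -
      have "(\<Sum>C\<in>P. card C - 2) = 1"
        using excess[OF PP] n by simp
      then obtain T where T: "T \<in> P" "card T - 2 = 1" "\<forall>C\<in>P. T \<noteq> C \<longrightarrow> card C - 2 = 0"
        using sum_eq_1_iff[OF P(2)[OF PP], of "\<lambda>C. card C - 2"] by blast
      have "\<forall>C\<in>P. 2 \<le> card C"
        using PP by (simp add: \<P>_def)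
      then have "card T = 3" "\<forall>C\<in>P. C \<noteq> T \<longrightarrow> card C = 2"
        using T(2,3) by (simp, metis diff_is_0_eq le_antisym)
      then show ?thesis
        using T by blast
    qed
    then obtain t where t: "\<And>P. P \<in> \<P> \<Longrightarrow> t P \<in> P" "\<And>P. P \<in> \<P> \<Longrightarrow> card (t P) = 3"
      "\<And>P C. P \<in> \<P> \<Longrightarrow> C \<in> P \<Longrightarrow> C \<noteq> t P \<Longrightarrow> card C = 2"
      by metis
    have other: "v \<notin> C" if "P \<in> \<P>" "v \<in> t P" "C \<in> P" "C \<noteq> t P" for P v C
      using partition_on_block_eq[OF P(1)] t that by blast
    have minus: "- {v} \<inter> C = (if C = t P then t P - {v} else C)" if "P \<in> \<P>" "v \<in> t P" "C \<in> P" for P v C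
      using other[OF that] by auto
    have card2: "card (- {v} \<inter> C) = 2" if "P \<in> \<P>" "v \<in> t P" "C \<in> P" for P v C
      unfolding minus[OF that] using t that by simp
    have del: "(\<inter>) (- {v}) ` P = insert (t P - {v}) (P - {t P})" if "P \<in> \<P>" "v \<in> t P" for P v
    proof -
      have "(\<inter>) (- {v}) ` P = (\<lambda>C. if C = t P then t P - {v} else C) ` P"
        using minus[OF that] by (rule image_cong[OF refl])
      also have "\<dots> = insert (t P - {v}) (P - {t P})"
        using t(1)[OF that(1)] by (auto split: if_splits)
      finally show ?thesis .
    qed
    have del_eq: "(\<inter>) (- {v}) ` P = (\<inter>) (- {v}) ` P'" if "P \<in> \<P>" "P' \<in> \<P>" "v \<in> t P" "v \<in> t P'" for P P' v
      using that by (intro unique card2)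
    \<comment> \<open>By \<open>del_eq\<close> the result does not depend on which partition with
      \<open>v\<close> in its triple is chosen.\<close>
    define Q where "Q = (\<lambda>v. (\<inter>) (- {v}) ` (SOME P. P \<in> \<P> \<and> v \<in> t P))"
    have Q: "Q v = insert (t P - {v}) (P - {t P})" if "P \<in> \<P>" "v \<in> t P" for P v
    proof -
      have "(SOME P. P \<in> \<P> \<and> v \<in> t P) \<in> \<P> \<and> v \<in> t (SOME P. P \<in> \<P> \<and> v \<in> t P)"
        by (rule someI_ex) (use that in blast)
      then have "Q v = (\<inter>) (- {v}) ` P"
        unfolding Q_def using that by (intro del_eq) auto
      then show ?thesis
        using del[OF that] by simp
    qed
    have "2 * card (t ` \<P>) < CARD('n)"
    proof (rule moving_matching_triples)
      show "card T = 3" if "T \<in> t ` \<P>" for T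
        using that t by blast
      show "T - {v} \<in> Q v" if "T \<in> t ` \<P>" "v \<in> T" for T v
        using that Q by auto
      show "C \<in> Q v'" if "T \<in> t ` \<P>" "v \<in> T" "v' \<in> T" "C \<in> Q v" "C \<noteq> T - {v}" for T v v' C
        using that Q by auto
      show "partition_on (- {v}) (Q v)" if T: "T \<in> t ` \<P>" "v \<in> T" for T v
      proof -
        obtain P' where P': "P' \<in> \<P>" "v \<in> t P'"
          using T by blast
        have "- {v} \<inter> C \<noteq> {}" if "C \<in> P'" for C
          using card2[OF P' that] by fastforce
        then show ?thesis
          unfolding Q[OF P'] del[OF P', symmetric] by (rule partition_on_Int[OF P(1)[OF P'(1)]])
      qed
    qed
    \<comment> \<open>A partition is recovered from its triple by restoring \<open>v\<close> to the
      pair \<open>t R - {v}\<close> in \<open>Q v\<close>; \<open>nin\<close> ensures that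
      discarding this pair loses no block of \<open>R\<close>.\<close>
    moreover have "inj_on t \<P>"
    proof (rule inj_onI)
      fix P1 P2 assume P12: "P1 \<in> \<P>" "P2 \<in> \<P>" "t P1 = t P2"
      obtain v where v: "v \<in> t P1"
        using t(2)[OF P12(1)] by fastforce
      have nin: "t R - {v} \<notin> R" if R: "R \<in> \<P>" "v \<in> t R" for R
      proof
        assume "t R - {v} \<in> R"
        moreover have "card (t R - {v}) = 2"
          using t(2) R by simp
        then obtain x where "x \<in> t R - {v}"
          by (metis all_not_in_conv card.empty zero_neq_numeral)
        ultimately have "t R - {v} = t R"
          using partition_on_block_eq[OF P(1)[OF R(1)]] t(1)[OF R(1)] by blast
        then show False
          using R by blast
      qed
      have "R = insert (t R) (Q v - {t R - {v}})" if "R \<in> \<P>" "v \<in> t R" for R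
        using Q[OF that] nin[OF that] t(1)[OF that(1)] by auto
      from this[of P1] this[of P2] show "P1 = P2"
        using P12 v by metis
    qed
    ultimately show ?thesis
      using assms(1) n by (simp add: card_image)
  qed
  show ?thesis
    using fin le even odd by (meson order_trans)
qed

end
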